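(* Let $A$ be a ring with $1$, $\sigma$ a ring endomorphism of $A$, $\delta$ a $\sigma$-derivation of $A$, and $R=A[t;\sigma,\delta]$. Let $f(t),g(t)\in R$ be monic polynomials of degree $n$ and $r$ respectively (with $n>0$). Suppose that $g(t)$ is a Wedderburn polynomial with $f(t)\in Rg(t)$, and let $C\subseteq A^n$ be the $(\sigma,\delta)$-$W$-code of length $n$ corresponding to the left cyclic $R$-module $Rg(t)/Rf(t)$. Let $a_1,\dots,a_r\in A$ be such that $Rg(t)=\bigcap_{i=1}^{r}R(t-a_i)$. Then $(c_0,c_1,\dots,c_{n-1})\in C$ if and only if $(c_0,c_1,\dots,c_{n-1})V_n(a_1,\dots,a_r)=(0,\dots,0)$.
   Context: A $\sigma$-derivation of $A$ is an additive map $\delta:A\to A$ with $\delta(ab)=\sigma(a)\delta(b)+\delta(a)b$ for all $a,b\in A$. Ring endomorphisms are unital. The skew polynomial (Ore) ring $R=A[t;\sigma,\delta]$ consists of the polynomials $\sum a_it^i$ with coefficients $a_i\in A$ written on the left, with usual addition and with multiplication determined by $ta=\sigma(a)t+\delta(a)$ for $a\in A$. Monic means leading coefficient $1$. For $i\ge 0$ and $a\in A$, $N_i(a)\in A$ is the evaluation of $t^i$ at $a$, i.e. the unique $s\in A$ with $t^i=q(t)(t-a)+s$ for some $q(t)\in R$. A monic polynomial $g(t)\in R$ of degree $r$ is a Wedderburn polynomial ($W$-polynomial) if there exist $a_1,\dots,a_r\in A$ with $Rg(t)=\bigcap_{i=1}^{r}R(t-a_i)$. $V_n(a_1,\dots,a_r)$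 is the $n\times r$ generalized Vandermonde matrix whose $(i+1,j)$ entry is $N_i(a_j)$, for $0\le i\le n-1$, $1\le j\le r$. Since $f$ is monic of degree $n$, every class in the left $R$-module $R/Rf$ has a unique representative $\sum_{i=0}^{n-1}c_it^i$. For a monic $g$ with $f\in Rg$, the code corresponding to $Rg/Rf$ is the set $C\subseteq A^n$ of coordinate vectors $(c_0,\dots,c_{n-1})$, in the basis $1,t,\dots,t^{n-1}$, of the elements of $Rg/Rf\subseteq R/Rf$; it is called a $(\sigma,\delta)$-$W$-code when $g$ is a $W$-polynomial. *)

theory Defs
  imports
    "HOL-Computational_Algebra.Polynomial"
    "HOL-Library.Set_Algebras"
    "Jordan_Normal_Form.Matrix"
begin

locale skew_derivation = Ring_Hom.ring_hom \<sigma>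
  for \<sigma> :: "'a :: ring_1 \<Rightarrow> 'a" +
  fixes \<delta> :: "'a \<Rightarrow> 'a"
  assumes der_add: "\<delta> (a + b) = \<delta> a + \<delta> b"
    and der_mult: "\<delta> (a * b) = \<sigma> a * \<delta> b + \<delta> a * b"

section \<open>The Ore extension\<close>

text \<open>
  The underlying additive group of the skew polynomial ring is the library type
  \<open>'a poly\<close>, a polynomial being read with its coefficients written on the left.
  The library product on \<open>'a poly\<close> (which exists only for commutative
  coefficients) is not used.  The rule \<open>t a = \<sigma>(a) t + \<delta>(a)\<close> gives
  \<open>t (\<Sum> b\<^sub>j t\<^sup>j) = \<Sum> \<sigma>(b\<^sub>j) t\<^sup>j\<^sup>+\<^sup>1 + \<Sum> \<delta>(b\<^sub>j) t\<^sup>j\<close>, and iterating it gives the product.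
\<close>

definition ore_scale :: "'a :: ring_1 \<Rightarrow> 'a poly \<Rightarrow> 'a poly" where
  "ore_scale a p = map_poly (\<lambda>b. a * b) p"

definition ore_shift :: "('a :: ring_1 \<Rightarrow> 'a) \<Rightarrow> ('a \<Rightarrow> 'a) \<Rightarrow> 'a poly \<Rightarrow> 'a poly" where
  "ore_shift \<sigma> \<delta> p = pCons 0 (map_poly \<sigma> p) + map_poly \<delta> p"

definition ore_mult ::
  "('a :: ring_1 \<Rightarrow> 'a) \<Rightarrow> ('a \<Rightarrow> 'a) \<Rightarrow> 'a poly \<Rightarrow> 'a poly \<Rightarrow> 'a poly" where
  "ore_mult \<sigma> \<delta> p q =
    (\<Sum>i\<le>degree p. ore_scale (coeff p i) ((ore_shift \<sigma> \<delta> ^^ i) q))"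

definition ore_ring :: "('a :: ring_1 \<Rightarrow> 'a) \<Rightarrow> ('a \<Rightarrow> 'a) \<Rightarrow> 'a poly ring" where
  "ore_ring \<sigma> \<delta> =
    \<lparr>carrier = UNIV, mult = ore_mult \<sigma> \<delta>, one = [:1:], zero = 0, add = (+)\<rparr>"

section \<open>Wedderburn polynomials, evaluation, codes\<close>

definition ore_lideal ::
  "('a :: ring_1 \<Rightarrow> 'a) \<Rightarrow> ('a \<Rightarrow> 'a) \<Rightarrow> 'a poly \<Rightarrow> 'a poly set" where
  "ore_lideal \<sigma> \<delta> g = {ore_mult \<sigma> \<delta> q g | q. True}"

definition wedderburn_poly ::
  "('a :: ring_1 \<Rightarrow> 'a) \<Rightarrow> ('a \<Rightarrow> 'a) \<Rightarrow> 'a poly \<Rightarrow> bool" where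
  "wedderburn_poly \<sigma> \<delta> g \<longleftrightarrow> lead_coeff g = 1 \<and>
    (\<exists>a :: nat \<Rightarrow> 'a. ore_lideal \<sigma> \<delta> g = (\<Inter>i<degree g. ore_lideal \<sigma> \<delta> [:- a i, 1:]))"

definition ore_N :: "('a :: ring_1 \<Rightarrow> 'a) \<Rightarrow> ('a \<Rightarrow> 'a) \<Rightarrow> nat \<Rightarrow> 'a \<Rightarrow> 'a" where
  "ore_N \<sigma> \<delta> i a = (THE s. \<exists>q. monom 1 i = ore_mult \<sigma> \<delta> q [:- a, 1:] + [:s:])"

definition ore_vandermonde ::
  "('a :: ring_1 \<Rightarrow> 'a) \<Rightarrow> ('a \<Rightarrow> 'a) \<Rightarrow> nat \<Rightarrow> nat \<Rightarrow> (nat \<Rightarrow> 'a) \<Rightarrow> 'a mat" where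
  "ore_vandermonde \<sigma> \<delta> n r a = mat n r (\<lambda>(i, j). ore_N \<sigma> \<delta> i (a j))"

definition poly_of_coords :: "'a :: ring_1 vec \<Rightarrow> 'a poly" where
  "poly_of_coords c = (\<Sum>i<dim_vec c. monom (c $ i) i)"

text \<open>\<open>Rg/Rf\<close>, as a set of cosets of \<open>Rf\<close>.\<close>

definition ore_quot ::
  "('a :: ring_1 \<Rightarrow> 'a) \<Rightarrow> ('a \<Rightarrow> 'a) \<Rightarrow> 'a poly \<Rightarrow> 'a poly \<Rightarrow> 'a poly set set" where
  "ore_quot \<sigma> \<delta> g f = {h +o ore_lideal \<sigma> \<delta> f | h. h \<in> ore_lideal \<sigma> \<delta> g}"

text \<open>For monic \<open>f\<close>, the vector \<open>c\<close> is the coordinate vector of the class of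
  \<open>poly_of_coords c\<close> modulo \<open>Rf\<close>.\<close>

definition ore_code ::
  "('a :: ring_1 \<Rightarrow> 'a) \<Rightarrow> ('a \<Rightarrow> 'a) \<Rightarrow> 'a poly \<Rightarrow> 'a poly \<Rightarrow> 'a vec set" where
  "ore_code \<sigma> \<delta> g f =
    {c \<in> carrier_vec (degree f). poly_of_coords c +o ore_lideal \<sigma> \<delta> f \<in> ore_quot \<sigma> \<delta> g f}"

section \<open>Well-definedness of the product and of the evaluation\<close>

lemma coeff_ore_scale [simp]: "coeff (ore_scale a p) n = a * coeff p n"
  by (simp add: ore_scale_def coeff_map_poly)

lemma ore_scale_0 [simp]: "ore_scale 0 p = 0" "ore_scale a 0 = 0"
  and ore_scale_1 [simp]: "ore_scale 1 p = p"
  and ore_scale_add: "ore_scale a (p + q) = ore_scale a p + ore_scale a q"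
  and ore_scale_add_left: "ore_scale (a + b) p = ore_scale a p + ore_scale b p"
  and ore_scale_scale: "ore_scale a (ore_scale b p) = ore_scale (a * b) p"
  by (auto intro!: poly_eqI simp: distrib_left distrib_right mult.assoc)

lemma ore_scale_sum: "ore_scale a (sum f I) = (\<Sum>i\<in>I. ore_scale a (f i))"
  by (induction I rule: infinite_finite_induct) (simp_all add: ore_scale_add)

lemma ore_mult_bound:
  assumes "degree p \<le> n"
  shows "ore_mult \<sigma> \<delta> p q = (\<Sum>i\<le>n. ore_scale (coeff p i) ((ore_shift \<sigma> \<delta> ^^ i) q))"
  unfolding ore_mult_def using assms
  by (intro sum.mono_neutral_left) (auto simp: coeff_eq_0)

context skew_derivation
begin

lemma der_0 [simp]: "\<delta> 0 = 0"
  using der_add[of 0 0] by simp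

lemma der_1 [simp]: "\<delta> 1 = 0"
  using der_mult[of 1 1] by simp

lemma coeff_ore_shift:
  "coeff (ore_shift \<sigma> \<delta> p) n = (if n = 0 then 0 else \<sigma> (coeff p (n - 1))) + \<delta> (coeff p n)"
  by (simp add: ore_shift_def coeff_map_poly coeff_pCons split: nat.split)

lemma ore_shift_0 [simp]: "ore_shift \<sigma> \<delta> 0 = 0"
  by (rule poly_eqI) (simp add: coeff_ore_shift)

lemma ore_shift_add: "ore_shift \<sigma> \<delta> (p + q) = ore_shift \<sigma> \<delta> p + ore_shift \<sigma> \<delta> q"
  by (rule poly_eqI) (simp add: coeff_ore_shift hom_add der_add)

lemma ore_shift_scale:
  "ore_shift \<sigma> \<delta> (ore_scale a p) = ore_scale (\<sigma> a) (ore_shift \<sigma> \<delta> p) + ore_scale (\<delta> a) p"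
  by (rule poly_eqI) (simp add: coeff_ore_shift hom_mult der_mult distrib_left add.assoc)

lemma ore_shift_sum: "ore_shift \<sigma> \<delta> (sum f I) = (\<Sum>i\<in>I. ore_shift \<sigma> \<delta> (f i))"
  by (induction I rule: infinite_finite_induct) (simp_all add: ore_shift_add)

lemma ore_shift_pow_0 [simp]: "(ore_shift \<sigma> \<delta> ^^ i) 0 = 0"
  by (induction i) simp_all

lemma ore_shift_pow_add:
  "(ore_shift \<sigma> \<delta> ^^ i) (p + q) = (ore_shift \<sigma> \<delta> ^^ i) p + (ore_shift \<sigma> \<delta> ^^ i) q"
  by (induction i) (simp_all add: ore_shift_add)

lemma ore_mult_add_right:
  "ore_mult \<sigma> \<delta> p (q + u) = ore_mult \<sigma> \<delta> p q + ore_mult \<sigma> \<delta> p u"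
  by (simp add: ore_mult_def ore_shift_pow_add ore_scale_add sum.distrib)

lemma ore_mult_add_left:
  "ore_mult \<sigma> \<delta> (p + q) u = ore_mult \<sigma> \<delta> p u + ore_mult \<sigma> \<delta> q u"
proof -
  let ?n = "max (degree p) (degree q)"
  have "degree (p + q) \<le> ?n" by (rule degree_add_le_max)
  then show ?thesis
    by (simp add: ore_mult_bound[of _ ?n] ore_scale_add_left sum.distrib)
qed

lemma ore_mult_0_left [simp]: "ore_mult \<sigma> \<delta> 0 u = 0"
  by (simp add: ore_mult_def)

lemma ore_mult_const: "ore_mult \<sigma> \<delta> [:a:] u = ore_scale a u"
  by (simp add: ore_mult_def)

lemma ore_mult_sum_left: "ore_mult \<sigma> \<delta> (sum f I) u = (\<Sum>i\<in>I. ore_mult \<sigma> \<delta> (f i) u)"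
  by (induction I rule: infinite_finite_induct) (simp_all add: ore_mult_add_left)

lemma ore_mult_scale_left:
  "ore_mult \<sigma> \<delta> (ore_scale a p) u = ore_scale a (ore_mult \<sigma> \<delta> p u)"
proof -
  have "degree (ore_scale a p) \<le> degree p"
    by (rule degree_le) (simp add: coeff_eq_0)
  then show ?thesis
    by (simp add: ore_mult_bound[of _ "degree p"] ore_scale_sum ore_scale_scale)
qed

lemma ore_mult_shift_left:
  "ore_mult \<sigma> \<delta> (ore_shift \<sigma> \<delta> p) u = ore_shift \<sigma> \<delta> (ore_mult \<sigma> \<delta> p u)"
proof -
  let ?n = "degree p" and ?S = "\<lambda>i. (ore_shift \<sigma> \<delta> ^^ i) u"
  have "degree (ore_shift \<sigma> \<delta> p) \<le> Suc ?n"
    by (rule degree_le) (auto simp: coeff_ore_shift coeff_eq_0)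
  then have "ore_mult \<sigma> \<delta> (ore_shift \<sigma> \<delta> p) u =
      (\<Sum>i\<le>Suc ?n. ore_scale (if i = 0 then 0 else \<sigma> (coeff p (i - 1))) (?S i)) +
      (\<Sum>i\<le>Suc ?n. ore_scale (\<delta> (coeff p i)) (?S i))"
    by (simp add: ore_mult_bound[of _ "Suc ?n"] coeff_ore_shift ore_scale_add_left
        sum.distrib del: sum.atMost_Suc)
  also have "(\<Sum>i\<le>Suc ?n. ore_scale (if i = 0 then 0 else \<sigma> (coeff p (i - 1))) (?S i)) =
      (\<Sum>i\<le>?n. ore_scale (\<sigma> (coeff p i)) (?S (Suc i)))"
    by (subst sum.atMost_Suc_shift) simp
  also have "(\<Sum>i\<le>Suc ?n. ore_scale (\<delta> (coeff p i)) (?S i)) =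
      (\<Sum>i\<le>?n. ore_scale (\<delta> (coeff p i)) (?S i))"
    by (simp add: coeff_eq_0)
  finally show ?thesis
    by (simp add: ore_mult_def ore_shift_sum ore_shift_scale sum.distrib)
qed

lemma ore_mult_assoc:
  "ore_mult \<sigma> \<delta> (ore_mult \<sigma> \<delta> p q) u = ore_mult \<sigma> \<delta> p (ore_mult \<sigma> \<delta> q u)"
proof -
  have "ore_mult \<sigma> \<delta> ((ore_shift \<sigma> \<delta> ^^ i) q) u = (ore_shift \<sigma> \<delta> ^^ i) (ore_mult \<sigma> \<delta> q u)" for i
    by (induction i) (simp_all add: ore_mult_shift_left)
  then show ?thesis
    by (simp add: ore_mult_def[of _ _ p] ore_mult_sum_left ore_mult_scale_left)
qed

lemma ore_shift_monom: "ore_shift \<sigma> \<delta> (monom 1 i) = monom 1 (Suc i)"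
  by (rule poly_eqI) (auto simp: coeff_ore_shift)

lemma ore_shift_pow_one: "(ore_shift \<sigma> \<delta> ^^ i) [:1:] = monom 1 i"
  by (induction i) (simp_all add: ore_shift_monom monom_0)

lemma ore_mult_one_right [simp]: "ore_mult \<sigma> \<delta> p [:1:] = p"
  by (rule poly_eqI)
    (auto simp: ore_mult_def ore_shift_pow_one coeff_sum if_distrib coeff_eq_0 cong: if_cong)

lemma ore_mult_var: "ore_mult \<sigma> \<delta> (monom 1 1) u = ore_shift \<sigma> \<delta> u"
  by (simp add: ore_mult_def degree_monom_eq)

theorem ring_ore_ring: "ring (ore_ring \<sigma> \<delta>)"
proof (rule ringI)
  have "\<exists>y. y + x = 0" for x :: "'a poly"
    by (rule exI[of _ "- x"]) simp
  then show "abelian_group (ore_ring \<sigma> \<delta>)"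
    by (intro abelian_groupI) (simp_all add: ore_ring_def add.assoc add.commute)
  show "Group.monoid (ore_ring \<sigma> \<delta>)"
    by (rule monoidI) (simp_all add: ore_ring_def ore_mult_assoc ore_mult_const)
qed (simp_all add: ore_ring_def ore_mult_add_left ore_mult_add_right)

text \<open>The defining relation of the ring, and \<open>t\<^sup>i\<close> as a power in it.\<close>

lemma ore_mult_var_const: "ore_mult \<sigma> \<delta> (monom 1 1) [:a:] = monom (\<sigma> a) 1 + [:\<delta> a:]"
  unfolding ore_mult_var
  by (rule poly_eqI) (auto simp: coeff_ore_shift coeff_pCons split: nat.split)

lemma ore_mult_const_monom: "ore_mult \<sigma> \<delta> [:a:] (monom 1 i) = monom a i"
  by (rule poly_eqI) (simp add: ore_mult_const)

lemma ore_mult_var_monom: "ore_mult \<sigma> \<delta> (monom 1 1) (monom 1 i) = monom 1 (Suc i)"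
  by (simp only: ore_mult_var ore_shift_monom)

text \<open>Right division by \<open>t - a\<close>: the definite description in \<open>ore_N\<close> is proper.\<close>

lemma coeff_ore_shift_pow_linear:
  "n > i \<Longrightarrow> coeff ((ore_shift \<sigma> \<delta> ^^ i) [:- a, 1:]) n = (if n = Suc i then 1 else 0)"
proof (induction i arbitrary: n)
  case 0
  then show ?case by (auto simp: coeff_pCons split: nat.split)
next
  case (Suc i)
  then show ?case by (auto simp: coeff_ore_shift)
qed

lemma coeff_ore_mult_linear:
  "coeff (ore_mult \<sigma> \<delta> q [:- a, 1:]) (Suc (degree q)) = lead_coeff q"
proof -
  have "coeff (ore_mult \<sigma> \<delta> q [:- a, 1:]) (Suc (degree q)) =
      (\<Sum>i\<le>degree q. if i = degree q then coeff q i else 0)"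
    unfolding ore_mult_def coeff_sum
    by (intro sum.cong) (auto simp: coeff_ore_shift_pow_linear)
  then show ?thesis by simp
qed

theorem ore_N_ex1: "\<exists>!s. \<exists>q. monom 1 i = ore_mult \<sigma> \<delta> q [:- a, 1:] + [:s:]"
proof (rule ex_ex1I)
  show "\<exists>s q. monom 1 i = ore_mult \<sigma> \<delta> q [:- a, 1:] + [:s:]"
  proof (induction i)
    case 0
    have "monom 1 0 = ore_mult \<sigma> \<delta> 0 [:- a, 1:] + [:1:]" by (simp add: monom_0)
    then show ?case by blast
  next
    case (Suc i)
    then obtain s q where "monom 1 i = ore_mult \<sigma> \<delta> q [:- a, 1:] + [:s:]" by blast
    then have "monom 1 (Suc i) = ore_shift \<sigma> \<delta> (ore_mult \<sigma> \<delta> q [:- a, 1:] + [:s:])"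
      by (metis ore_shift_monom)
    also have "\<dots> = ore_mult \<sigma> \<delta> (ore_shift \<sigma> \<delta> q) [:- a, 1:] + ore_shift \<sigma> \<delta> [:s:]"
      by (simp add: ore_shift_add ore_mult_shift_left)
    also have "ore_shift \<sigma> \<delta> [:s:] = ore_scale (\<sigma> s) [:- a, 1:] + [:\<sigma> s * a + \<delta> s:]"
      by (rule poly_eqI) (auto simp: coeff_ore_shift coeff_pCons split: nat.split)
    also have "ore_mult \<sigma> \<delta> (ore_shift \<sigma> \<delta> q) [:- a, 1:] + \<dots> =
        ore_mult \<sigma> \<delta> (ore_shift \<sigma> \<delta> q + [:\<sigma> s:]) [:- a, 1:] + [:\<sigma> s * a + \<delta> s:]"
      by (simp only: ore_mult_add_left ore_mult_const add.assoc)
    finally show ?case by blast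
  qed
next
  fix s s'
  assume "\<exists>q. monom 1 i = ore_mult \<sigma> \<delta> q [:- a, 1:] + [:s:]"
    and "\<exists>q. monom 1 i = ore_mult \<sigma> \<delta> q [:- a, 1:] + [:s':]"
  then obtain q q' where
    eq: "ore_mult \<sigma> \<delta> q [:- a, 1:] + [:s:] = ore_mult \<sigma> \<delta> q' [:- a, 1:] + [:s':]"
    by metis
  define d where "d = q - q'"
  have "ore_mult \<sigma> \<delta> q [:- a, 1:] = ore_mult \<sigma> \<delta> d [:- a, 1:] + ore_mult \<sigma> \<delta> q' [:- a, 1:]"
    by (simp add: d_def flip: ore_mult_add_left)
  with eq have *: "ore_mult \<sigma> \<delta> d [:- a, 1:] + [:s:] = [:s':]"
    by (simp add: algebra_simps)
  have "lead_coeff d = coeff (ore_mult \<sigma> \<delta> d [:- a, 1:] + [:s:]) (Suc (degree d))"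
    by (simp add: coeff_ore_mult_linear)
  then have "d = 0" unfolding * by simp
  with * show "s = s'" by simp
qed

end

end

(*
  Since Rf is contained in Rg, membership in the code means that p = c_0 + ... + c_{n-1} t^{n-1}
  itself lies in Rg, hence in every R(t - a_j). The evaluation of polynomials at a_j is left
  A-linear, so right division of p by t - a_j leaves the remainder c_0 N_0(a_j) + ... + c_{n-1} N_{n-1}(a_j), which is
  the j-th entry of the product of c with the Vandermonde matrix.
*)
theory Submission
  imports Defs
begin

context skew_derivation
begin

lemma ore_lideal_add:
  "\<lbrakk>p \<in> ore_lideal \<sigma> \<delta> g; q \<in> ore_lideal \<sigma> \<delta> g\<rbrakk> \<Longrightarrow> p + q \<in> ore_lideal \<sigma> \<delta> g"
  unfolding ore_lideal_def by (auto simp flip: ore_mult_add_left)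

lemma zero_in_ore_lideal: "0 \<in> ore_lideal \<sigma> \<delta> g"
  unfolding ore_lideal_def using ore_mult_0_left[of g] by (metis (mono_tags, lifting) mem_Collect_eq)

lemma ore_lideal_subset: "f \<in> ore_lideal \<sigma> \<delta> g \<Longrightarrow> ore_lideal \<sigma> \<delta> f \<subseteq> ore_lideal \<sigma> \<delta> g"
  unfolding ore_lideal_def by (auto simp flip: ore_mult_assoc)

text \<open>The left ideal is an additive subgroup, so adding one of its elements does not affect
  membership. This discards the quotient term of a right division.\<close>

lemma ore_lideal_add_iff:
  assumes "p \<in> ore_lideal \<sigma> \<delta> g"
  shows "p + q \<in> ore_lideal \<sigma> \<delta> g \<longleftrightarrow> q \<in> ore_lideal \<sigma> \<delta> g"
proof
  assume "p + q \<in> ore_lideal \<sigma> \<delta> g"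
  moreover obtain u where u: "p = ore_mult \<sigma> \<delta> u g"
    using assms by (auto simp: ore_lideal_def)
  \<comment> \<open>Additivity in the left factor identifies \<open>(- u) g\<close> with
    \<open>- (u g)\<close>, which gives closure under negation.\<close>
  have "ore_mult \<sigma> \<delta> (- u) g + ore_mult \<sigma> \<delta> u g = 0"
    by (simp flip: ore_mult_add_left)
  then have "- p = ore_mult \<sigma> \<delta> (- u) g"
    unfolding u by (simp add: eq_neg_iff_add_eq_0 [symmetric])
  then have "- p \<in> ore_lideal \<sigma> \<delta> g"
    by (auto simp: ore_lideal_def)
  ultimately have "- p + (p + q) \<in> ore_lideal \<sigma> \<delta> g"
    by (rule ore_lideal_add[rotated])
  then show "q \<in> ore_lideal \<sigma> \<delta> g"
    by simp
qed (use assms ore_lideal_add in blast)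

text \<open>Because t - a is monic, a nonzero left factor q gives a product of degree at least 1,
  even if A has zero divisors.\<close>

lemma const_in_ore_lideal_linear: "[:s:] \<in> ore_lideal \<sigma> \<delta> [:- a, 1:] \<longleftrightarrow> s = 0"
proof
  assume "[:s:] \<in> ore_lideal \<sigma> \<delta> [:- a, 1:]"
  then obtain q where q: "[:s:] = ore_mult \<sigma> \<delta> q [:- a, 1:]"
    by (auto simp: ore_lideal_def)
  \<comment> \<open>The index \<open>Suc (degree q)\<close> is positive, so the constant polynomial
    has coefficient 0 there.\<close>
  have "lead_coeff q = coeff [:s:] (Suc (degree q))"
    unfolding q by (simp only: coeff_ore_mult_linear)
  then have "q = 0"
    by simp
  with q show "s = 0"
    by simp
qed (simp add: zero_in_ore_lideal)

lemma ore_N_remainder: "\<exists>q. monom 1 i = ore_mult \<sigma> \<delta> q [:- a, 1:] + [:ore_N \<sigma> \<delta> i a:]"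
  unfolding ore_N_def by (rule theI'[OF ore_N_ex1])

lemma poly_of_coords_remainder:
  "\<exists>q. poly_of_coords c =
    ore_mult \<sigma> \<delta> q [:- a, 1:] + [:\<Sum>i<dim_vec c. c $ i * ore_N \<sigma> \<delta> i a:]"
proof -
  \<comment> \<open>The quotients are chosen as a function of the exponent, so that they can be
    summed.\<close>
  obtain q where q: "\<And>i. monom 1 i = ore_mult \<sigma> \<delta> (q i) [:- a, 1:] + [:ore_N \<sigma> \<delta> i a:]"
    using ore_N_remainder[of _ a] by metis
  have scale_const: "ore_scale b [:s:] = [:b * s:]" for b s :: 'a
    by (rule poly_eqI) (auto simp: coeff_pCons split: nat.split)
  have sum_const: "(\<Sum>i\<in>I. [:h i:]) = [:sum h I:]" for h :: "nat \<Rightarrow> 'a" and I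
    by (induction I rule: infinite_finite_induct) auto
  \<comment> \<open>Coefficients stand on the left while t - a divides on the right, so scaling by
    \<open>c $ i\<close> passes to quotient and remainder separately.\<close>
  have "monom (c $ i) i = ore_mult \<sigma> \<delta> (ore_scale (c $ i) (q i)) [:- a, 1:] +
      [:c $ i * ore_N \<sigma> \<delta> i a:]" for i
  proof -
    have "monom (c $ i) i = ore_scale (c $ i) (monom 1 i)"
      by (rule poly_eqI) simp
    then show ?thesis
      by (simp only: q ore_scale_add scale_const ore_mult_scale_left)
  qed
  then have "poly_of_coords c =
      ore_mult \<sigma> \<delta> (\<Sum>i<dim_vec c. ore_scale (c $ i) (q i)) [:- a, 1:] +
      [:\<Sum>i<dim_vec c. c $ i * ore_N \<sigma> \<delta> i a:]"
    by (simp only: poly_of_coords_def ore_mult_sum_left sum.distrib sum_const)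
  then show ?thesis
    by blast
qed

lemma poly_of_coords_in_ore_lideal_linear:
  "poly_of_coords c \<in> ore_lideal \<sigma> \<delta> [:- a, 1:] \<longleftrightarrow>
    (\<Sum>i<dim_vec c. c $ i * ore_N \<sigma> \<delta> i a) = 0"
proof -
  obtain q where q: "poly_of_coords c =
      ore_mult \<sigma> \<delta> q [:- a, 1:] + [:\<Sum>i<dim_vec c. c $ i * ore_N \<sigma> \<delta> i a:]"
    using poly_of_coords_remainder by blast
  have "ore_mult \<sigma> \<delta> q [:- a, 1:] \<in> ore_lideal \<sigma> \<delta> [:- a, 1:]"
    by (auto simp: ore_lideal_def)
  then show ?thesis
    unfolding q by (simp only: ore_lideal_add_iff const_in_ore_lideal_linear)
qed

text \<open>Two representatives of a coset differ by an element of Rf, and Rf lies in Rg; hence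
  membership in Rg does not depend on the representative. That p lies in its own coset uses 0 in
  Rf.\<close>

lemma coset_in_ore_quot:
  assumes "f \<in> ore_lideal \<sigma> \<delta> g"
  shows "p +o ore_lideal \<sigma> \<delta> f \<in> ore_quot \<sigma> \<delta> g f \<longleftrightarrow> p \<in> ore_lideal \<sigma> \<delta> g"
proof
  assume "p +o ore_lideal \<sigma> \<delta> f \<in> ore_quot \<sigma> \<delta> g f"
  then obtain h where h: "h \<in> ore_lideal \<sigma> \<delta> g"
    and eq: "p +o ore_lideal \<sigma> \<delta> f = h +o ore_lideal \<sigma> \<delta> f"
    by (auto simp: ore_quot_def)
  have "p \<in> p +o ore_lideal \<sigma> \<delta> f"
    using set_plus_intro2[OF zero_in_ore_lideal, of p f] by simp
  then obtain u where "u \<in> ore_lideal \<sigma> \<delta> f" "p = h + u"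
    unfolding eq by (auto simp: elt_set_plus_def)
  then show "p \<in> ore_lideal \<sigma> \<delta> g"
    using h ore_lideal_add ore_lideal_subset[OF assms] by blast
qed (auto simp: ore_quot_def)

end

lemma row_times_ore_vandermonde_eq_0:
  assumes "c \<in> carrier_vec n"
  shows "mat_of_row c * ore_vandermonde \<sigma> \<delta> n r a = 0\<^sub>m 1 r \<longleftrightarrow>
    (\<forall>j<r. (\<Sum>i<dim_vec c. c $ i * ore_N \<sigma> \<delta> i (a j)) = 0)"
proof -
  have "(mat_of_row c * ore_vandermonde \<sigma> \<delta> n r a) $$ (0, j) =
      (\<Sum>i<dim_vec c. c $ i * ore_N \<sigma> \<delta> i (a j))" if "j < r" for j
    using that assms
    by (auto simp: ore_vandermonde_def scalar_prod_def atLeast0LessThan intro!: sum.cong)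
  then show ?thesis
    by (auto simp: mat_eq_iff ore_vandermonde_def)
qed

theorem proposition4p3:
  fixes \<sigma> \<delta> :: "'a :: ring_1 \<Rightarrow> 'a"
    and f g :: "'a poly" and n r :: nat
    and a :: "nat \<Rightarrow> 'a" and C :: "'a vec set" and c :: "'a vec"
  assumes "skew_derivation \<sigma> \<delta>"
    and "lead_coeff f = 1" and "degree f = n" and "n > 0"
    and "lead_coeff g = 1" and "degree g = r"
    and "wedderburn_poly \<sigma> \<delta> g"
    and "f \<in> ore_lideal \<sigma> \<delta> g"
    and "C = ore_code \<sigma> \<delta> g f"
    and "ore_lideal \<sigma> \<delta> g = (\<Inter>i<r. ore_lideal \<sigma> \<delta> [:- a i, 1:])"
    and "c \<in> carrier_vec n"
  shows "c \<in> C \<longleftrightarrow> mat_of_row c * ore_vandermonde \<sigma> \<delta> n r a = 0\<^sub>m 1 r"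
proof -
  interpret skew_derivation \<sigma> \<delta> by fact
  have "c \<in> C \<longleftrightarrow> poly_of_coords c \<in> ore_lideal \<sigma> \<delta> g"
    using assms by (simp add: ore_code_def coset_in_ore_quot)
  \<comment> \<open>Membership in the intersection splits into one vanishing remainder for each
    \<open>a j\<close>. For \<open>r = 0\<close> the intersection is all of R and the condition is
    vacuous.\<close>
  also have "\<dots> \<longleftrightarrow> (\<forall>j<r. (\<Sum>i<dim_vec c. c $ i * ore_N \<sigma> \<delta> i (a j)) = 0)"
    unfolding \<open>ore_lideal \<sigma> \<delta> g = _\<close> by (auto simp: poly_of_coords_in_ore_lideal_linear)
  also have "\<dots> \<longleftrightarrow> mat_of_row c * ore_vandermonde \<sigma> \<delta> n r a = 0\<^sub>m 1 r"
    using row_times_ore_vandermonde_eq_0[OF \<open>c \<in> carrier_vec n\<close>] by simp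
  finally show ?thesis .
qed

end
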